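(* Let $\Omega\subset\mathbb R^n$ be a smooth bounded domain, let $V$ be a potential on $\Omega$, and let $K_i$, $i\in J$, be a finite family of compact sets included in $\Omega$. Assume that $\mathrm{Cap}_{V,\infty}(K_i)=0$ for all $i\in J$. Then $$\mathrm{Cap}_{V,\infty}\Big(\bigcup_{i\in J}K_i\Big)=0.$$
   Context: A potential on $\Omega$ is a measurable function $V:\Omega\to[0,+\infty]$ that is not identically zero (a.e.). For $\psi\in C^2_c(\Omega)$, $$\|\psi\|_{V,\infty}=\|\psi\|_{L^1(\Omega)}+\Big\|\frac{\nabla\psi}{\sqrt V}\Big\|_{L^\infty(\Omega)}+\Big\|\frac{\Delta\psi}{V}\Big\|_{L^\infty(\Omega)}\in[0,+\infty],$$ where a quotient is taken to be $0$ where its numerator vanishes or where $V=+\infty$, and to be $+\infty$ in absolute value where $V=0$ and the numerator is nonzero. For a compact $K\subset\Omega$, $$\mathbb B^2_K=\{\psi\in C^2_c(\Omega):\ 0\le\psi\le1,\ \psi=1\text{ in a neighborhood of }K\},\qquad \mathrm{Cap}_{V,\infty}(K)=\inf\{\|\psi\|_{V,\infty}:\ \psi\in\mathbb B^2_K\}.$$ *)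

theory Defs
  imports "HOL-Analysis.Analysis" "HOL-Probability.Essential_Supremum"
begin

definition partial_deriv :: "'n::finite \<Rightarrow> (real ^ 'n \<Rightarrow> real) \<Rightarrow> real ^ 'n \<Rightarrow> real" where
  "partial_deriv i f x = frechet_derivative f (at x) (axis i 1)"

definition grad :: "(real ^ 'n::finite \<Rightarrow> real) \<Rightarrow> real ^ 'n \<Rightarrow> real ^ 'n" where
  "grad f x = (\<chi> i. partial_deriv i f x)"

definition laplacian :: "(real ^ 'n::finite \<Rightarrow> real) \<Rightarrow> real ^ 'n \<Rightarrow> real" where
  "laplacian f x = (\<Sum>i\<in>UNIV. partial_deriv i (partial_deriv i f) x)"

text \<open>Functions of class $C^k$; the definition is intended for open sets \<open>S\<close>.\<close>

fun Ck_on :: "nat \<Rightarrow> (real ^ 'n::finite \<Rightarrow> real) \<Rightarrow> (real ^ 'n) set \<Rightarrow> bool" where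
  "Ck_on 0 f S \<longleftrightarrow> continuous_on S f"
| "Ck_on (Suc k) f S \<longleftrightarrow>
     (\<forall>x\<in>S. f differentiable at x) \<and> (\<forall>i. Ck_on k (partial_deriv i f) S)"

definition smooth_on :: "(real ^ 'n::finite \<Rightarrow> real) \<Rightarrow> (real ^ 'n) set \<Rightarrow> bool" where
  "smooth_on f S \<longleftrightarrow> (\<forall>k. Ck_on k f S)"

text \<open>The boundary is locally the graph of a smooth function of the coordinates other than the
  \<open>i\<close>-th, with \<open>\<Omega>\<close> lying on one side of it. A function of these $n - 1$ coordinates is a function
  on the whole space that does not depend on the \<open>i\<close>-th coordinate, and \<open>s\<close> is the orientation
  of the \<open>i\<close>-th axis.\<close>

definition smooth_boundary :: "(real ^ 'n::finite) set \<Rightarrow> bool" where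
  "smooth_boundary \<Omega> \<longleftrightarrow>
     (\<forall>p\<in>frontier \<Omega>. \<exists>r>0. \<exists>i. \<exists>s\<in>{1, -1}. \<exists>\<gamma>.
        smooth_on \<gamma> UNIV \<and> (\<forall>x t. \<gamma> (x + t *\<^sub>R axis i 1) = \<gamma> x) \<and>
        \<Omega> \<inter> ball p r = {x \<in> ball p r. \<gamma> x < s * (x $ i)})"

definition smooth_bounded_domain :: "(real ^ 'n::finite) set \<Rightarrow> bool" where
  "smooth_bounded_domain \<Omega> \<longleftrightarrow>
     open \<Omega> \<and> connected \<Omega> \<and> \<Omega> \<noteq> {} \<and> bounded \<Omega> \<and> smooth_boundary \<Omega>"

text \<open>Only the values of \<open>V\<close> on \<open>\<Omega>\<close> are relevant.\<close>

definition potential :: "(real ^ 'n::finite) set \<Rightarrow> (real ^ 'n \<Rightarrow> ennreal) \<Rightarrow> bool" where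
  "potential \<Omega> V \<longleftrightarrow>
     V \<in> borel_measurable (lebesgue_on \<Omega>) \<and> \<not> (AE x in lebesgue_on \<Omega>. V x = 0)"

text \<open>Elements of $C^2_c(\Omega)$ are identified with their extensions by zero to the whole space.\<close>

definition C2c :: "(real ^ 'n::finite) set \<Rightarrow> (real ^ 'n \<Rightarrow> real) set" where
  "C2c \<Omega> = {\<psi>. Ck_on 2 \<psi> \<Omega> \<and> compact (closure {x. \<psi> x \<noteq> 0}) \<and> closure {x. \<psi> x \<noteq> 0} \<subseteq> \<Omega>}"

definition ennsqrt :: "ennreal \<Rightarrow> ennreal" where
  "ennsqrt v = (if v = \<infinity> then \<infinity> else ennreal (sqrt (enn2real v)))"

text \<open>The quotients below are taken in \<^typ>\<open>ennreal\<close>, whose division obeys the required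
  conventions.\<close>

lemma ennreal_quotient_conventions:
  fixes a v :: ennreal
  shows "0 / v = 0" and "a < \<infinity> \<Longrightarrow> a / \<infinity> = 0" and "a \<noteq> 0 \<Longrightarrow> a / 0 = \<infinity>"
  by (auto simp: ennreal_divide_zero)

lemma ennsqrt_eq_0_iff: "ennsqrt v = 0 \<longleftrightarrow> v = 0"
  and ennsqrt_eq_infinity_iff: "ennsqrt v = \<infinity> \<longleftrightarrow> v = \<infinity>"
  by (cases v; auto simp: ennsqrt_def ennreal_eq_0_iff top_unique)+

definition norm_V_infty ::
  "(real ^ 'n::finite) set \<Rightarrow> (real ^ 'n \<Rightarrow> ennreal) \<Rightarrow> (real ^ 'n \<Rightarrow> real) \<Rightarrow> ennreal" where
  "norm_V_infty \<Omega> V \<psi> =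
     (\<integral>\<^sup>+ x. ennreal \<bar>\<psi> x\<bar> \<partial>lebesgue_on \<Omega>)
     + esssup (lebesgue_on \<Omega>) (\<lambda>x. ennreal (norm (grad \<psi> x)) / ennsqrt (V x))
     + esssup (lebesgue_on \<Omega>) (\<lambda>x. ennreal \<bar>laplacian \<psi> x\<bar> / V x)"

definition B2 :: "(real ^ 'n::finite) set \<Rightarrow> (real ^ 'n) set \<Rightarrow> (real ^ 'n \<Rightarrow> real) set" where
  "B2 \<Omega> K = {\<psi> \<in> C2c \<Omega>. (\<forall>x. 0 \<le> \<psi> x \<and> \<psi> x \<le> 1) \<and> (\<exists>U. open U \<and> K \<subseteq> U \<and> (\<forall>x\<in>U. \<psi> x = 1))}"

definition Cap_V_infty ::
  "(real ^ 'n::finite) set \<Rightarrow> (real ^ 'n \<Rightarrow> ennreal) \<Rightarrow> (real ^ 'n) set \<Rightarrow> ennreal" where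
  "Cap_V_infty \<Omega> V K = (INF \<psi>\<in>B2 \<Omega> K. norm_V_infty \<Omega> V \<psi>)"

end

theory Submission
  imports Defs
begin

text \<open>Test functions \<open>\<phi>\<close> for \<open>K\<close> and \<open>\<psi>\<close> for \<open>L\<close> are combined into the smooth substitute
  \<open>\<chi> = \<phi> + \<psi> - \<phi> \<psi>\<close> for their maximum. Since \<open>1 - \<chi> = (1 - \<phi>) (1 - \<psi>)\<close>, this function again takes
  its values in \<open>[0, 1]\<close> and is \<open>1\<close> wherever \<open>\<phi>\<close> or \<open>\<psi>\<close> is, hence near \<open>K \<union> L\<close>. On \<open>\<Omega>\<close>,
  \<open>\<nabla>\<chi> = (1 - \<psi>) \<nabla>\<phi> + (1 - \<phi>) \<nabla>\<psi>\<close> and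
  \<open>\<Delta>\<chi> = (1 - \<psi>) \<Delta>\<phi> + (1 - \<phi>) \<Delta>\<psi> - 2 \<nabla>\<phi> \<bullet> \<nabla>\<psi>\<close>.
  The weight \<open>1 / \<surd>V\<close> on gradients is matched to the weight \<open>1 / V\<close> on Laplacians in such a way that
  the cross term is controlled by Cauchy-Schwarz:
  \<open>\<bar>\<nabla>\<phi> \<bullet> \<nabla>\<psi>\<bar> / V \<le> (\<bar>\<nabla>\<phi>\<bar> / \<surd>V) (\<bar>\<nabla>\<psi>\<bar> / \<surd>V)\<close>. With \<open>a\<close> and \<open>b\<close> the norms of \<open>\<phi>\<close> and \<open>\<psi>\<close>, the norm of
  \<open>\<chi>\<close> is therefore at most \<open>a + b + 2 a b\<close> (lemma \<open>norm_V_infty_prob_sum_le\<close>), which is small when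
  \<open>a\<close> and \<open>b\<close> are. This settles two compact sets, and induction on the family does the rest.\<close>

section \<open>Calculus of partial derivatives\<close>

lemma partial_deriv_cong:
  assumes "f differentiable at x" "open S" "x \<in> S" "\<And>y. y \<in> S \<Longrightarrow> f y = g y"
  shows "partial_deriv i f x = partial_deriv i g x"
  unfolding partial_deriv_def
  using frechet_derivative_transform_within_open[OF assms] by simp

lemma differentiable_cong_open:
  assumes "f differentiable at x" "open S" "x \<in> S" "\<And>y. y \<in> S \<Longrightarrow> f y = g y"
  shows "g differentiable at x"
  using assms unfolding differentiable_def by (meson has_derivative_transform_within_open)

lemma partial_deriv_const: "partial_deriv i (\<lambda>x. c) x = 0"
  by (simp add: partial_deriv_def)

lemma partial_deriv_add:
  assumes "f differentiable at x" "g differentiable at x"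
  shows "partial_deriv i (\<lambda>x. f x + g x) x = partial_deriv i f x + partial_deriv i g x"
proof -
  have "((\<lambda>x. f x + g x) has_derivative
      (\<lambda>h. frechet_derivative f (at x) h + frechet_derivative g (at x) h)) (at x)"
    using assms by (intro has_derivative_add) (simp_all flip: frechet_derivative_works)
  from frechet_derivative_at[OF this, symmetric] show ?thesis by (simp add: partial_deriv_def)
qed

lemma partial_deriv_diff:
  assumes "f differentiable at x" "g differentiable at x"
  shows "partial_deriv i (\<lambda>x. f x - g x) x = partial_deriv i f x - partial_deriv i g x"
proof -
  have "((\<lambda>x. f x - g x) has_derivative
      (\<lambda>h. frechet_derivative f (at x) h - frechet_derivative g (at x) h)) (at x)"
    using assms by (intro has_derivative_diff) (simp_all flip: frechet_derivative_works)
  from frechet_derivative_at[OF this, symmetric] show ?thesis by (simp add: partial_deriv_def)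
qed

lemma partial_deriv_mult:
  assumes "f differentiable at x" "g differentiable at x"
  shows "partial_deriv i (\<lambda>x. f x * g x) x = f x * partial_deriv i g x + partial_deriv i f x * g x"
proof -
  have "((\<lambda>x. f x * g x) has_derivative
      (\<lambda>h. f x * frechet_derivative g (at x) h + frechet_derivative f (at x) h * g x)) (at x)"
    using assms by (intro has_derivative_mult) (simp_all flip: frechet_derivative_works)
  from frechet_derivative_at[OF this, symmetric] show ?thesis by (simp add: partial_deriv_def)
qed

section \<open>Closure properties of the differentiability classes\<close>

lemma Ck_on_cong:
  assumes "Ck_on k f S" "open S" "\<And>x. x \<in> S \<Longrightarrow> f x = g x"
  shows "Ck_on k g S"
  using assms
proof (induction k arbitrary: f g)
  case 0
  then show ?case using continuous_on_cong[of S S f g] by simp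
next
  case (Suc k)
  have "Ck_on k (partial_deriv i g) S" for i
  proof (rule Suc.IH[of "partial_deriv i f"])
    show "partial_deriv i f x = partial_deriv i g x" if "x \<in> S" for x
      using Suc.prems that by (intro partial_deriv_cong[of f x S]) simp_all
  qed (use Suc.prems in simp_all)
  then show ?case using Suc.prems by (auto intro: differentiable_cong_open[of f _ S])
qed

lemma Ck_on_Suc_imp_Ck_on: "Ck_on (Suc k) f S \<Longrightarrow> Ck_on k f S"
proof (induction k arbitrary: f)
  case 0
  then show ?case
    by (auto intro!: continuous_at_imp_continuous_on differentiable_imp_continuous_within)
next
  case (Suc k)
  have "\<forall>x\<in>S. f differentiable at x" and "\<And>i. Ck_on (Suc k) (partial_deriv i f) S"
    using Suc.prems Ck_on.simps(2)[of "Suc k" f S] by blast+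
  then show ?case using Suc.IH by (simp only: Ck_on.simps(2)) blast
qed

lemma Ck_on_add:
  assumes "open S" "Ck_on k f S" "Ck_on k g S"
  shows "Ck_on k (\<lambda>x. f x + g x) S"
  using assms(2,3)
proof (induction k arbitrary: f g)
  case 0
  then show ?case by (simp add: continuous_on_add)
next
  case (Suc k)
  have "Ck_on k (\<lambda>x. partial_deriv i f x + partial_deriv i g x) S" for i
    using Suc.prems by (intro Suc.IH) simp_all
  then have "Ck_on k (partial_deriv i (\<lambda>x. f x + g x)) S" for i
    using \<open>open S\<close> by (rule Ck_on_cong) (use Suc.prems in \<open>simp_all add: partial_deriv_add\<close>)
  then show ?case using Suc.prems by simp
qed

lemma Ck_on_diff:
  assumes "open S" "Ck_on k f S" "Ck_on k g S"
  shows "Ck_on k (\<lambda>x. f x - g x) S"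
  using assms(2,3)
proof (induction k arbitrary: f g)
  case 0
  then show ?case by (simp add: continuous_on_diff)
next
  case (Suc k)
  have "Ck_on k (\<lambda>x. partial_deriv i f x - partial_deriv i g x) S" for i
    using Suc.prems by (intro Suc.IH) simp_all
  then have "Ck_on k (partial_deriv i (\<lambda>x. f x - g x)) S" for i
    using \<open>open S\<close> by (rule Ck_on_cong) (use Suc.prems in \<open>simp_all add: partial_deriv_diff\<close>)
  then show ?case using Suc.prems by simp
qed

lemma Ck_on_mult:
  assumes "open S" "Ck_on k f S" "Ck_on k g S"
  shows "Ck_on k (\<lambda>x. f x * g x) S"
  using assms(2,3)
proof (induction k arbitrary: f g)
  case 0
  then show ?case by (simp add: continuous_on_mult)
next
  case (Suc k)
  have fg: "Ck_on k f S" "Ck_on k g S"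
    using Suc.prems Ck_on_Suc_imp_Ck_on by blast+
  have "Ck_on k (\<lambda>x. f x * partial_deriv i g x + partial_deriv i f x * g x) S" for i
    using Suc.prems fg \<open>open S\<close> by (intro Ck_on_add Suc.IH) simp_all
  then have "Ck_on k (partial_deriv i (\<lambda>x. f x * g x)) S" for i
    using \<open>open S\<close> by (rule Ck_on_cong) (use Suc.prems in \<open>simp_all add: partial_deriv_mult\<close>)
  then show ?case using Suc.prems by simp
qed

lemma Ck_on_const: "Ck_on k (\<lambda>x. c) S"
proof (induction k arbitrary: c)
  case (Suc k)
  have "partial_deriv i (\<lambda>x. c) = (\<lambda>x. 0)" for i :: 'a
    by (simp add: fun_eq_iff partial_deriv_const)
  with Suc show ?case by simp
qed simp

lemma Ck_on_2_imp:
  assumes "Ck_on 2 f S"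
  shows "continuous_on S f"
    and "\<And>x. x \<in> S \<Longrightarrow> f differentiable at x"
    and "\<And>i. continuous_on S (partial_deriv i f)"
    and "\<And>i x. x \<in> S \<Longrightarrow> partial_deriv i f differentiable at x"
    and "\<And>i j. continuous_on S (partial_deriv j (partial_deriv i f))"
proof -
  have C2: "Ck_on (Suc (Suc 0)) f S" using assms by (simp only: numeral_2_eq_2)
  from C2 show "x \<in> S \<Longrightarrow> f differentiable at x"
    and "x \<in> S \<Longrightarrow> partial_deriv i f differentiable at x"
    and "continuous_on S (partial_deriv j (partial_deriv i f))" for x i j
    by simp_all
  show "continuous_on S f"
    using C2[THEN Ck_on_Suc_imp_Ck_on, THEN Ck_on_Suc_imp_Ck_on] by simp
  show "continuous_on S (partial_deriv i f)" for i
    using C2[THEN Ck_on_Suc_imp_Ck_on] by simp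
qed

section \<open>The probabilistic sum of two functions\<close>

text \<open>If \<open>f\<close> and \<open>g\<close> are probabilities of independent events, then this is the probability of their
  union.\<close>

definition prob_sum :: "('a \<Rightarrow> real) \<Rightarrow> ('a \<Rightarrow> real) \<Rightarrow> 'a \<Rightarrow> real" where
  "prob_sum f g x = f x + g x - f x * g x"

lemma prob_sum_eq: "prob_sum f g x = 1 - (1 - f x) * (1 - g x)"
  by (simp add: prob_sum_def algebra_simps)

lemma Ck_on_prob_sum:
  "open S \<Longrightarrow> Ck_on k f S \<Longrightarrow> Ck_on k g S \<Longrightarrow> Ck_on k (prob_sum f g) S"
  unfolding prob_sum_def[abs_def] by (intro Ck_on_diff Ck_on_add Ck_on_mult)

lemma prob_sum_in_B2:
  assumes "open \<Omega>" "\<phi> \<in> B2 \<Omega> K" "\<psi> \<in> B2 \<Omega> L"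
  shows "prob_sum \<phi> \<psi> \<in> B2 \<Omega> (K \<union> L)"
proof -
  have \<phi>: "Ck_on 2 \<phi> \<Omega>" "compact (closure {x. \<phi> x \<noteq> 0})" "closure {x. \<phi> x \<noteq> 0} \<subseteq> \<Omega>"
    and \<psi>: "Ck_on 2 \<psi> \<Omega>" "compact (closure {x. \<psi> x \<noteq> 0})" "closure {x. \<psi> x \<noteq> 0} \<subseteq> \<Omega>"
    and range: "0 \<le> \<phi> x" "\<phi> x \<le> 1" "0 \<le> \<psi> x" "\<psi> x \<le> 1" for x
    using assms by (auto simp: B2_def C2c_def)
  let ?supp = "closure {x. \<phi> x \<noteq> 0} \<union> closure {x. \<psi> x \<noteq> 0}"
  have "{x. prob_sum \<phi> \<psi> x \<noteq> 0} \<subseteq> {x. \<phi> x \<noteq> 0} \<union> {x. \<psi> x \<noteq> 0}"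
    by (auto simp: prob_sum_def)
  then have supp: "closure {x. prob_sum \<phi> \<psi> x \<noteq> 0} \<subseteq> ?supp"
    by (metis closure_Un closure_mono)
  have "compact (closure {x. prob_sum \<phi> \<psi> x \<noteq> 0})"
    using compact_Int_closed[OF compact_Un[OF \<phi>(2) \<psi>(2)] closed_closure[of "{x. prob_sum \<phi> \<psi> x \<noteq> 0}"]]
      supp
    by (simp add: Int_absorb1)
  then have "prob_sum \<phi> \<psi> \<in> C2c \<Omega>"
    using supp \<phi> \<psi> Ck_on_prob_sum[OF \<open>open \<Omega>\<close> \<phi>(1) \<psi>(1)] by (auto simp: C2c_def)
  moreover have "0 \<le> prob_sum \<phi> \<psi> x \<and> prob_sum \<phi> \<psi> x \<le> 1" for x
    using range[of x] mult_le_one[of "1 - \<phi> x" "1 - \<psi> x"] by (simp add: prob_sum_eq)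
  moreover have "\<exists>W. open W \<and> K \<union> L \<subseteq> W \<and> (\<forall>x\<in>W. prob_sum \<phi> \<psi> x = 1)"
  proof -
    obtain U U' where "open U" "K \<subseteq> U" "\<forall>x\<in>U. \<phi> x = 1" "open U'" "L \<subseteq> U'" "\<forall>x\<in>U'. \<psi> x = 1"
      using assms(2,3) by (auto simp: B2_def)
    then show ?thesis by (intro exI[of _ "U \<union> U'"]) (auto simp: prob_sum_eq)
  qed
  ultimately show ?thesis by (simp add: B2_def)
qed

lemma partial_deriv_prob_sum:
  assumes "f differentiable at x" "g differentiable at x"
  shows "partial_deriv i (prob_sum f g) x
    = (1 - g x) * partial_deriv i f x + (1 - f x) * partial_deriv i g x"
  unfolding prob_sum_def[abs_def]
  using assms
  by (simp add: partial_deriv_diff partial_deriv_add partial_deriv_mult algebra_simps)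

lemma grad_prob_sum:
  assumes "f differentiable at x" "g differentiable at x"
  shows "grad (prob_sum f g) x = (1 - g x) *\<^sub>R grad f x + (1 - f x) *\<^sub>R grad g x"
  by (simp add: vec_eq_iff grad_def partial_deriv_prob_sum[OF assms])

lemma laplacian_prob_sum:
  assumes "open S" "Ck_on 2 f S" "Ck_on 2 g S" "x \<in> S"
  shows "laplacian (prob_sum f g) x
    = (1 - g x) * laplacian f x + (1 - f x) * laplacian g x - 2 * (grad f x \<bullet> grad g x)"
proof -
  note f = Ck_on_2_imp[OF assms(2)] and g = Ck_on_2_imp[OF assms(3)]
    and h = Ck_on_2_imp[OF Ck_on_prob_sum[OF assms(1-3)]]
  have "partial_deriv i (partial_deriv i (prob_sum f g)) x
      = (1 - g x) * partial_deriv i (partial_deriv i f) x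
        + (1 - f x) * partial_deriv i (partial_deriv i g) x
        - 2 * (partial_deriv i f x * partial_deriv i g x)" for i
  proof -
    have "partial_deriv i (partial_deriv i (prob_sum f g)) x
      = partial_deriv i (\<lambda>y. (1 - g y) * partial_deriv i f y + (1 - f y) * partial_deriv i g y) x"
      by (rule partial_deriv_cong[OF h(4) assms(1,4)])
         (simp_all add: assms(4) f g partial_deriv_prob_sum)
    also have "\<dots> = (1 - g x) * partial_deriv i (partial_deriv i f) x
        + (1 - f x) * partial_deriv i (partial_deriv i g) x
        - 2 * (partial_deriv i f x * partial_deriv i g x)"
      using f(2,4)[OF assms(4)] g(2,4)[OF assms(4)]
      by (simp add: partial_deriv_diff partial_deriv_add partial_deriv_mult partial_deriv_const
          algebra_simps)
    finally show ?thesis .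
  qed
  then show ?thesis
    by (simp add: laplacian_def grad_def inner_vec_def sum.distrib sum_subtractf sum_distrib_left)
qed

section \<open>Measurability of the weighted quotients\<close>

lemma measurable_ennsqrt [measurable (raw)]:
  assumes [measurable]: "V \<in> borel_measurable M"
  shows "(\<lambda>x. ennsqrt (V x)) \<in> borel_measurable M"
  unfolding ennsqrt_def by measurable

text \<open>The essential supremum of a non-measurable function is \<open>\<infinity>\<close> by convention, so these facts are
  indispensable for bounding the norm from above.\<close>

lemma measurable_C2:
  assumes "open \<Omega>" "Ck_on 2 \<psi> \<Omega>"
  shows "\<psi> \<in> borel_measurable (lebesgue_on \<Omega>)"
    and "(\<lambda>x. norm (grad \<psi> x)) \<in> borel_measurable (lebesgue_on \<Omega>)"
    and "laplacian \<psi> \<in> borel_measurable (lebesgue_on \<Omega>)"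
proof -
  note C2 = Ck_on_2_imp[OF assms(2)]
  have \<Omega>: "\<Omega> \<in> sets lebesgue" using \<open>open \<Omega>\<close> by auto
  show "\<psi> \<in> borel_measurable (lebesgue_on \<Omega>)"
    by (intro continuous_imp_measurable_on_sets_lebesgue \<Omega> C2)
  have "continuous_on \<Omega> (grad \<psi>)"
    unfolding grad_def[abs_def] by (intro continuous_intros C2)
  then show "(\<lambda>x. norm (grad \<psi> x)) \<in> borel_measurable (lebesgue_on \<Omega>)"
    by (intro continuous_imp_measurable_on_sets_lebesgue \<Omega> continuous_on_norm)
  show "laplacian \<psi> \<in> borel_measurable (lebesgue_on \<Omega>)"
    unfolding laplacian_def[abs_def]
    by (intro continuous_imp_measurable_on_sets_lebesgue \<Omega> continuous_intros C2)
qed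

section \<open>Subadditivity up to a product term\<close>

text \<open>This is what matches the two weights. It survives the degenerate values: for \<open>v = \<infinity>\<close> both sides
  vanish, and for \<open>v = 0\<close> both are \<open>\<infinity>\<close> if \<open>s\<close> and \<open>t\<close> are nonzero, and \<open>0\<close> otherwise because
  \<open>0 * \<infinity> = 0\<close>.\<close>

lemma ennreal_mult_divide_eq_ennsqrt:
  fixes s t :: real
  assumes "0 \<le> s" "0 \<le> t"
  shows "ennreal (s * t) / v = (ennreal s / ennsqrt v) * (ennreal t / ennsqrt v)"
proof (cases v)
  case (real r)
  show ?thesis
  proof (cases "r = 0")
    case True
    then show ?thesis
      using real assms by (auto simp: ennsqrt_def ennreal_mult ennreal_mult_top ennreal_eq_0_iff)
  next
    case False
    then show ?thesis
      using real assms
      by (simp add: ennsqrt_def divide_ennreal flip: ennreal_mult)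
  qed
qed (simp add: ennsqrt_def)

lemma ennreal_divide_le_add:
  fixes s t u :: real
  assumes "u \<le> s + t" "0 \<le> s" "0 \<le> t"
  shows "ennreal u / w \<le> ennreal s / w + ennreal t / w"
proof -
  have "ennreal u / w \<le> ennreal (s + t) / w"
    using assms by (intro divide_right_mono_ennreal ennreal_leI)
  then show ?thesis using assms by (simp add: add_divide_distrib_ennreal)
qed

text \<open>The product term comes from the mixed gradient term of the Laplacian alone. The other terms of
  the gradient and of the Laplacian have the coefficients \<open>1 - \<phi>\<close> and \<open>1 - \<psi>\<close>, which lie in \<open>[0, 1]\<close>,
  so the triangle inequality bounds them by the sum of the two norms. The $L^1$ part is subadditive
  because \<open>\<phi> + \<psi> - \<phi> \<psi> \<le> \<phi> + \<psi>\<close>.\<close>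

lemma norm_V_infty_prob_sum_le:
  assumes "open \<Omega>" and V: "V \<in> borel_measurable (lebesgue_on \<Omega>)"
    and "Ck_on 2 \<phi> \<Omega>" "Ck_on 2 \<psi> \<Omega>"
    and range: "\<And>x. 0 \<le> \<phi> x \<and> \<phi> x \<le> 1" "\<And>x. 0 \<le> \<psi> x \<and> \<psi> x \<le> 1"
  shows "norm_V_infty \<Omega> V (prob_sum \<phi> \<psi>)
    \<le> norm_V_infty \<Omega> V \<phi> + norm_V_infty \<Omega> V \<psi>
      + 2 * (norm_V_infty \<Omega> V \<phi> * norm_V_infty \<Omega> V \<psi>)"
proof -
  let ?M = "lebesgue_on \<Omega>"
  let ?\<chi> = "prob_sum \<phi> \<psi>"
  define I where "I f = (\<integral>\<^sup>+ x. ennreal \<bar>f x\<bar> \<partial>?M)" for f :: "real ^ 'a \<Rightarrow> real"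
  define g where "g f x = ennreal (norm (grad f x)) / ennsqrt (V x)" for f x
  define l where "l f x = ennreal \<bar>laplacian f x\<bar> / V x" for f x
  define G where "G f = esssup ?M (g f)" for f
  define L where "L f = esssup ?M (l f)" for f
  have norm: "norm_V_infty \<Omega> V f = I f + G f + L f" for f
    by (simp add: norm_V_infty_def I_def G_def L_def g_def[abs_def] l_def[abs_def])
  note [measurable] = V measurable_C2[OF assms(1,3)] measurable_C2[OF assms(1,4)]
    measurable_C2[OF assms(1) Ck_on_prob_sum[OF assms(1,3,4)]]
  have coeff: "\<bar>1 - \<phi> x\<bar> \<le> 1" "\<bar>1 - \<psi> x\<bar> \<le> 1" for x
    using range[of x] by auto
  note scale = mult_left_le_one_le[OF _ abs_ge_zero]

  have "I ?\<chi> \<le> (\<integral>\<^sup>+ x. ennreal \<bar>\<phi> x\<bar> + ennreal \<bar>\<psi> x\<bar> \<partial>?M)"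
    unfolding I_def
  proof (rule nn_integral_mono)
    fix x
    have "0 \<le> ?\<chi> x" "?\<chi> x \<le> \<phi> x + \<psi> x"
      using range[of x] mult_le_one[of "1 - \<phi> x" "1 - \<psi> x"] by (simp_all add: prob_sum_eq algebra_simps)
    then show "ennreal \<bar>?\<chi> x\<bar> \<le> ennreal \<bar>\<phi> x\<bar> + ennreal \<bar>\<psi> x\<bar>"
      using range[of x] by (simp flip: ennreal_plus)
  qed
  also have "\<dots> = I \<phi> + I \<psi>"
    unfolding I_def by (rule nn_integral_add) measurable
  finally have I: "I ?\<chi> \<le> I \<phi> + I \<psi>" .

  have g_bound: "AE x in ?M. g \<phi> x \<le> G \<phi>" "AE x in ?M. g \<psi> x \<le> G \<psi>"
    and l_bound: "AE x in ?M. l \<phi> x \<le> L \<phi>" "AE x in ?M. l \<psi> x \<le> L \<psi>"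
    unfolding G_def L_def by (rule esssup_AE)+

  have "g ?\<chi> x \<le> g \<phi> x + g \<psi> x" if "x \<in> \<Omega>" for x
  proof -
    have "norm (grad ?\<chi> x) = norm ((1 - \<psi> x) *\<^sub>R grad \<phi> x + (1 - \<phi> x) *\<^sub>R grad \<psi> x)"
      using that by (simp add: grad_prob_sum Ck_on_2_imp(2)[OF assms(3)] Ck_on_2_imp(2)[OF assms(4)])
    also have "\<dots> \<le> norm (grad \<phi> x) + norm (grad \<psi> x)"
      by (rule norm_triangle_le) (auto intro!: add_mono scale coeff)
    finally show ?thesis unfolding g_def by (rule ennreal_divide_le_add) simp_all
  qed
  then have "AE x in ?M. g ?\<chi> x \<le> g \<phi> x + g \<psi> x" by (intro AE_I2) simp
  then have "AE x in ?M. g ?\<chi> x \<le> G \<phi> + G \<psi>"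
    using g_bound by eventually_elim (meson add_mono order_trans)
  then have G: "G ?\<chi> \<le> G \<phi> + G \<psi>"
    unfolding G_def by (intro esssup_I) (simp_all add: g_def[abs_def])

  have "l ?\<chi> x \<le> l \<phi> x + l \<psi> x + 2 * (g \<phi> x * g \<psi> x)" if "x \<in> \<Omega>" for x
  proof -
    let ?c = "2 * (norm (grad \<phi> x) * norm (grad \<psi> x))"
    have "\<bar>laplacian ?\<chi> x\<bar>
        \<le> \<bar>(1 - \<psi> x) * laplacian \<phi> x\<bar> + \<bar>(1 - \<phi> x) * laplacian \<psi> x\<bar> + 2 * \<bar>grad \<phi> x \<bullet> grad \<psi> x\<bar>"
      unfolding laplacian_prob_sum[OF assms(1,3,4) that] by linarith
    also have "\<dots> \<le> \<bar>laplacian \<phi> x\<bar> + \<bar>laplacian \<psi> x\<bar> + ?c"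
      unfolding abs_mult by (intro add_mono mult_left_mono scale coeff Cauchy_Schwarz_ineq2) simp_all
    finally have "l ?\<chi> x \<le> ennreal (\<bar>laplacian \<phi> x\<bar> + \<bar>laplacian \<psi> x\<bar>) / V x + ennreal ?c / V x"
      unfolding l_def by (rule ennreal_divide_le_add) simp_all
    also have "\<dots> = l \<phi> x + l \<psi> x
        + 2 * (ennreal (norm (grad \<phi> x) * norm (grad \<psi> x)) / V x)"
      by (simp add: l_def add_divide_distrib_ennreal ennreal_mult' ennreal_times_divide)
    also have "\<dots> = l \<phi> x + l \<psi> x + 2 * (g \<phi> x * g \<psi> x)"
      by (simp add: g_def ennreal_mult_divide_eq_ennsqrt)
    finally show ?thesis .
  qed
  then have "AE x in ?M. l ?\<chi> x \<le> l \<phi> x + l \<psi> x + 2 * (g \<phi> x * g \<psi> x)" by (intro AE_I2) simp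
  then have "AE x in ?M. l ?\<chi> x \<le> L \<phi> + L \<psi> + 2 * (G \<phi> * G \<psi>)"
    using g_bound l_bound
    by eventually_elim (erule order_trans, intro add_mono mult_mono, simp_all)
  then have L: "L ?\<chi> \<le> L \<phi> + L \<psi> + 2 * (G \<phi> * G \<psi>)"
    unfolding L_def by (intro esssup_I) (simp_all add: l_def[abs_def])

  have "norm_V_infty \<Omega> V ?\<chi>
      \<le> (I \<phi> + I \<psi>) + (G \<phi> + G \<psi>) + (L \<phi> + L \<psi> + 2 * (G \<phi> * G \<psi>))"
    unfolding norm by (intro add_mono I G L)
  also have "\<dots> = norm_V_infty \<Omega> V \<phi> + norm_V_infty \<Omega> V \<psi> + 2 * (G \<phi> * G \<psi>)"
    unfolding norm by (simp add: ac_simps)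
  also have "\<dots> \<le> norm_V_infty \<Omega> V \<phi> + norm_V_infty \<Omega> V \<psi>
      + 2 * (norm_V_infty \<Omega> V \<phi> * norm_V_infty \<Omega> V \<psi>)"
    unfolding norm
    by (intro add_left_mono mult_left_mono mult_mono) (simp_all add: add_increasing add_increasing2)
  finally show ?thesis .
qed

section \<open>Unions of sets of capacity zero\<close>

lemma Cap_V_infty_empty: "Cap_V_infty \<Omega> V {} = 0"
proof -
  have zero: "partial_deriv i (\<lambda>x. 0) = (\<lambda>x. 0)" for i :: 'a
    by (simp add: fun_eq_iff partial_deriv_const)
  have "(\<lambda>x. 0) \<in> B2 \<Omega> {}"
    using Ck_on_const by (auto simp: B2_def C2c_def)
  then have "Cap_V_infty \<Omega> V {} \<le> norm_V_infty \<Omega> V (\<lambda>x. 0)"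
    unfolding Cap_V_infty_def by (rule INF_lower)
  also have "\<dots> = 0"
  proof -
    have "esssup (lebesgue_on \<Omega>) (\<lambda>x. 0 :: ennreal) = 0"
      using esssup_I[of "\<lambda>x. 0" "lebesgue_on \<Omega>" "0 :: ennreal"] by simp
    then show ?thesis
      by (simp add: norm_V_infty_def grad_def laplacian_def zero flip: zero_vec_def)
  qed
  finally show ?thesis by simp
qed

lemma Cap_V_infty_Un_eq_0:
  assumes "open \<Omega>" "V \<in> borel_measurable (lebesgue_on \<Omega>)"
    and "Cap_V_infty \<Omega> V K = 0" "Cap_V_infty \<Omega> V L = 0"
  shows "Cap_V_infty \<Omega> V (K \<union> L) = 0"
proof -
  have "Cap_V_infty \<Omega> V (K \<union> L) \<le> 0 + ennreal e" if "0 < e" for e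
  proof -
    \<comment> \<open>The two linear terms and the doubled product term contribute at most \<open>4 d\<close>, the last one
      because \<open>d \<le> 1\<close>.\<close>
    define d where "d = min (e / 4) 1"
    have d: "0 < d" "d \<le> 1" "4 * d \<le> e" using that by (auto simp: d_def)
    have "Cap_V_infty \<Omega> V K < ennreal d" "Cap_V_infty \<Omega> V L < ennreal d"
      using assms(3,4) d by simp_all
    then obtain \<phi> \<psi> where \<phi>: "\<phi> \<in> B2 \<Omega> K" "norm_V_infty \<Omega> V \<phi> < ennreal d"
      and \<psi>: "\<psi> \<in> B2 \<Omega> L" "norm_V_infty \<Omega> V \<psi> < ennreal d"
      unfolding Cap_V_infty_def INF_less_iff by blast
    have "Cap_V_infty \<Omega> V (K \<union> L) \<le> norm_V_infty \<Omega> V (prob_sum \<phi> \<psi>)"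
      unfolding Cap_V_infty_def by (rule INF_lower[OF prob_sum_in_B2[OF assms(1) \<phi>(1) \<psi>(1)]])
    also have "\<dots> \<le> norm_V_infty \<Omega> V \<phi> + norm_V_infty \<Omega> V \<psi>
        + 2 * (norm_V_infty \<Omega> V \<phi> * norm_V_infty \<Omega> V \<psi>)"
      using \<phi>(1) \<psi>(1) by (intro norm_V_infty_prob_sum_le assms) (auto simp: B2_def C2c_def)
    also have "\<dots> \<le> ennreal d + ennreal d + 2 * (ennreal d * ennreal d)"
      using \<phi>(2) \<psi>(2) by (intro add_mono mult_left_mono mult_mono) simp_all
    also have "\<dots> = ennreal (2 * d + 2 * (d * d))"
    proof -
      have "2 * (ennreal d * ennreal d) = ennreal (2 * (d * d))"
        using d by (simp add: ennreal_mult)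
      then show ?thesis using d by (simp flip: ennreal_plus)
    qed
    also have "\<dots> \<le> ennreal e"
      using d mult_left_le[of d d] by (intro ennreal_leI) linarith
    finally show ?thesis by simp
  qed
  then have "Cap_V_infty \<Omega> V (K \<union> L) \<le> 0" by (rule ennreal_le_epsilon)
  then show ?thesis by simp
qed

theorem theorem3:
  fixes \<Omega> :: "(real ^ 'n::finite) set"
    and V :: "real ^ 'n \<Rightarrow> ennreal"
    and K :: "'i \<Rightarrow> (real ^ 'n) set"
    and J :: "'i set"
  assumes "smooth_bounded_domain \<Omega>"
    and "potential \<Omega> V"
    and "finite J"
    and "\<And>i. i \<in> J \<Longrightarrow> compact (K i)"
    and "\<And>i. i \<in> J \<Longrightarrow> K i \<subseteq> \<Omega>"
    and "\<And>i. i \<in> J \<Longrightarrow> Cap_V_infty \<Omega> V (K i) = 0"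
  shows "Cap_V_infty \<Omega> V (\<Union>i\<in>J. K i) = 0"
proof -
  have \<Omega>V: "open \<Omega>" "V \<in> borel_measurable (lebesgue_on \<Omega>)"
    using assms(1,2) by (auto simp: smooth_bounded_domain_def potential_def)
  show ?thesis
    using assms(3,6)
  proof (induction J rule: finite_induct)
    case empty
    show ?case by (simp add: Cap_V_infty_empty)
  next
    case (insert i J)
    then show ?case by (simp add: Cap_V_infty_Un_eq_0[OF \<Omega>V])
  qed
qed

end
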